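(* Let $G$ be a finite group such that $\gamma(G)=1$. Then $$|\mathrm{Im}\, f_1|=\begin{cases} 3, & \text{if } G \text{ is isomorphic to a group of type (1)},\\ 1, & \text{if } G \text{ is isomorphic to a group of type (2)},\end{cases}$$ where the types are: (1) $N\rtimes P$, where $N\cong\mathbb{Z}_p$, $P\cong\mathbb{Z}_{q^n}$, $[N,\Phi(P)]=1$, $p,q$ are primes such that $q\mid p-1$, and $n$ is a positive integer; (2) $M(p^n)=\langle x,y \mid x^{p^{n-1}}=y^p=1,\ x^y=x^{1+p^{n-2}}\rangle$, where $p$ is a prime and $n\ge 3$ if $p\ge 3$, or $n\ge 4$ if $p=2$.
   Context: For a finite group $G$, $\gamma(G)$ denotes the number of conjugacy classes of non-normal subgroups of $G$. $L(G)$ denotes the set of all subgroups of $G$ and $L_1(G)$ the set of all cyclic subgroups of $G$. For $H\in L(G)$, $$csd(H,G)=\frac{1}{|L_1(H)||L_1(G)|}\left|\{(H_1,G_1)\in L_1(H)\times L_1(G) \mid H_1G_1=G_1H_1\}\right|.$$ The function $f_1:L(G)\to[0,1]$ is given by $f_1(H)=csd(H,G)$, so $|\mathrm{Im}\, f_1|$ is the number of distinct values of $csd(H,G)$, $H\in L(G)$. $\Phi(P)$ is the Frattini subgroup of $P$, and $x^y=y^{-1}xy$. It is a known classification (recalled by the paper from the literature) that a finite group $G$ satisfies $\gamma(G)=1$ if and only if it is isomorphic to one of the groups of types (1), (2). *)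

theory Defs
  imports Complex_Main "HOL-Algebra.Group_Action" "HOL-Algebra.Elementary_Groups" "HOL-Computational_Algebra.Primes"
begin

definition subgroups :: "('a, 'm) monoid_scheme \<Rightarrow> 'a set set" where
  "subgroups G = {H. subgroup H G}"

definition cyclic_subgroups :: "('a, 'm) monoid_scheme \<Rightarrow> 'a set set" where
  "cyclic_subgroups G = {H. subgroup H G \<and> cyclic_group (G\<lparr>carrier := H\<rparr>)}"

definition gamma :: "('a, 'm) monoid_scheme \<Rightarrow> nat" where
  "gamma G = card (orbits G {H. subgroup H G \<and> \<not> H \<lhd> G}
                     (\<lambda>g H. g <#\<^bsub>G\<^esub> H #>\<^bsub>G\<^esub> inv\<^bsub>G\<^esub> g))"

definition csd :: "'a set \<Rightarrow> ('a, 'm) monoid_scheme \<Rightarrow> real" where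
  "csd H G =
     1 / (real (card (cyclic_subgroups (G\<lparr>carrier := H\<rparr>))) * real (card (cyclic_subgroups G)))
     * real (card {(H1, G1) \<in> cyclic_subgroups (G\<lparr>carrier := H\<rparr>) \<times> cyclic_subgroups G.
                     H1 <#>\<^bsub>G\<^esub> G1 = G1 <#>\<^bsub>G\<^esub> H1})"

definition Im_f1 :: "('a, 'm) monoid_scheme \<Rightarrow> real set" where
  "Im_f1 G = (\<lambda>H. csd H G) ` subgroups G"


definition maximal_subgroup :: "'a set \<Rightarrow> ('a, 'm) monoid_scheme \<Rightarrow> bool" where
  "maximal_subgroup M G \<longleftrightarrow> subgroup M G \<and> M \<noteq> carrier G \<and>
     (\<forall>K. subgroup K G \<and> M \<subseteq> K \<longrightarrow> K = M \<or> K = carrier G)"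

text \<open>If there are no maximal subgroups, the intersection is the whole group.\<close>

definition frattini :: "('a, 'm) monoid_scheme \<Rightarrow> 'a set" where
  "frattini G = carrier G \<inter> \<Inter>{M. maximal_subgroup M G}"

definition commutator_subgroup :: "('a, 'm) monoid_scheme \<Rightarrow> 'a set \<Rightarrow> 'a set \<Rightarrow> 'a set" where
  "commutator_subgroup G A B =
     generate G {inv\<^bsub>G\<^esub> a \<otimes>\<^bsub>G\<^esub> inv\<^bsub>G\<^esub> b \<otimes>\<^bsub>G\<^esub> a \<otimes>\<^bsub>G\<^esub> b | a b. a \<in> A \<and> b \<in> B}"

definition semidirect_product :: "('a, 'm) monoid_scheme \<Rightarrow> 'a set \<Rightarrow> 'a set \<Rightarrow> bool" where
  "semidirect_product G N P \<longleftrightarrow>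
     group G \<and> N \<lhd> G \<and> subgroup P G \<and> N <#>\<^bsub>G\<^esub> P = carrier G \<and> N \<inter> P = {\<one>\<^bsub>G\<^esub>}"

text \<open>The semidirect product is internal, so that the commutator \<open>[N, \<Phi>(P)]\<close> makes sense.
  It may be direct; such groups are abelian and have \<open>gamma G = 0\<close>.\<close>

definition type1 :: "('a, 'm) monoid_scheme \<Rightarrow> nat \<Rightarrow> nat \<Rightarrow> nat \<Rightarrow> bool" where
  "type1 G p q n \<longleftrightarrow>
     prime p \<and> prime q \<and> q dvd p - 1 \<and> n > 0 \<and>
     (\<exists>N P. semidirect_product G N P \<and>
        G\<lparr>carrier := N\<rparr> \<cong> integer_mod_group p \<and>
        G\<lparr>carrier := P\<rparr> \<cong> integer_mod_group (q ^ n) \<and>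
        commutator_subgroup G N (frattini (G\<lparr>carrier := P\<rparr>)) = {\<one>\<^bsub>G\<^esub>})"


text \<open>Group presentations. A word is a list of letters, where \<open>(g, True)\<close> stands for the
  generator \<open>g\<close> and \<open>(g, False)\<close> for its inverse; a pair \<open>(l, r) \<in> R\<close> stands for the
  relation \<open>l = r\<close>.\<close>

type_synonym 'g word = "('g \<times> bool) list"

inductive word_eq :: "('g word \<times> 'g word) set \<Rightarrow> 'g word \<Rightarrow> 'g word \<Rightarrow> bool"
  for R where
  refl: "word_eq R w w"
| sym: "word_eq R v w \<Longrightarrow> word_eq R w v"
| trans: "word_eq R u v \<Longrightarrow> word_eq R v w \<Longrightarrow> word_eq R u w"
| cancel: "word_eq R (u @ [(g, b), (g, \<not> b)] @ v) (u @ v)"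
| relation: "(l, r) \<in> R \<Longrightarrow> word_eq R (u @ l @ v) (u @ r @ v)"

definition word_class :: "('g word \<times> 'g word) set \<Rightarrow> 'g word \<Rightarrow> 'g word set" where
  "word_class R w = {v. word_eq R w v}"

definition presented_group :: "('g word \<times> 'g word) set \<Rightarrow> 'g word set monoid" where
  "presented_group R =
     \<lparr>carrier = range (word_class R),
      monoid.mult = (\<lambda>A B. \<Union>a\<in>A. \<Union>b\<in>B. word_class R (a @ b)),
      one = word_class R []\<rparr>"

lemma word_eq_append_left: "word_eq R v w \<Longrightarrow> word_eq R (u @ v) (u @ w)"
proof (induction rule: word_eq.induct)
  case (refl w)
  show ?case by (rule word_eq.refl)
next
  case (sym v w)
  show ?case by (rule word_eq.sym[OF sym.IH])
next
  case (trans a b c)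
  show ?case by (rule word_eq.trans[OF trans.IH])
next
  case (cancel a g b v)
  show ?case using word_eq.cancel[of R "u @ a" g b v] by simp
next
  case (relation l r a v)
  then show ?case using word_eq.relation[of l r R "u @ a" v] by simp
qed

lemma word_eq_append_right: "word_eq R v w \<Longrightarrow> word_eq R (v @ u) (w @ u)"
proof (induction rule: word_eq.induct)
  case (refl w)
  show ?case by (rule word_eq.refl)
next
  case (sym v w)
  show ?case by (rule word_eq.sym[OF sym.IH])
next
  case (trans a b c)
  show ?case by (rule word_eq.trans[OF trans.IH])
next
  case (cancel a g b v)
  show ?case using word_eq.cancel[of R a g b "v @ u"] by simp
next
  case (relation l r a v)
  then show ?case using word_eq.relation[of l r R a "v @ u"] by simp
qed

lemma word_class_eq_iff: "word_class R v = word_class R w \<longleftrightarrow> word_eq R v w"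
proof
  assume "word_class R v = word_class R w"
  then show "word_eq R v w" by (auto simp: word_class_def set_eq_iff word_eq.refl)
next
  assume *: "word_eq R v w"
  have "word_eq R v u \<longleftrightarrow> word_eq R w u" for u
    using word_eq.trans[OF *] word_eq.trans[OF word_eq.sym[OF *]] by metis
  then show "word_class R v = word_class R w" by (simp add: word_class_def)
qed

lemma presented_group_mult:
  "word_class R v \<otimes>\<^bsub>presented_group R\<^esub> word_class R w = word_class R (v @ w)"
proof -
  have "word_class R (a @ b) = word_class R (v @ w)"
    if "a \<in> word_class R v" "b \<in> word_class R w" for a b
  proof -
    have "word_eq R v a" "word_eq R w b" using that by (simp_all add: word_class_def)
    then have "word_eq R (v @ w) (a @ b)"
      by (intro word_eq.trans[OF word_eq_append_right word_eq_append_left])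
    then show ?thesis by (simp add: word_class_eq_iff word_eq.sym)
  qed
  then have "(\<Union>a\<in>word_class R v. \<Union>b\<in>word_class R w. word_class R (a @ b))
      = (\<Union>a\<in>word_class R v. \<Union>b\<in>word_class R w. word_class R (v @ w))"
    by (intro SUP_cong HOL.refl)
  also have "\<dots> = word_class R (v @ w)"
    using word_eq.refl[of R v] word_eq.refl[of R w] by (auto simp: word_class_def)
  finally show ?thesis by (simp add: presented_group_def)
qed

lemma word_eq_inverse: "word_eq R (rev (map (\<lambda>(g, b). (g, \<not> b)) w) @ w) []"
proof (induction w)
  case (Cons a w)
  obtain g b where a: "a = (g, b)" by force
  let ?i = "rev (map (\<lambda>(g, b). (g, \<not> b)) w)"
  have "word_eq R (?i @ [(g, \<not> b), (g, b)] @ w) (?i @ w)"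
    using word_eq.cancel[of R ?i g "\<not> b" w] by simp
  from word_eq.trans[OF this Cons.IH] show ?case by (simp add: a)
qed (simp add: word_eq.refl)

lemma group_presented_group: "group (presented_group R)"
proof (rule groupI)
  fix x assume "x \<in> carrier (presented_group R)"
  then obtain w where x: "x = word_class R w" by (auto simp: presented_group_def)
  let ?y = "word_class R (rev (map (\<lambda>(g, b). (g, \<not> b)) w))"
  have "?y \<otimes>\<^bsub>presented_group R\<^esub> x = \<one>\<^bsub>presented_group R\<^esub>"
    unfolding x presented_group_mult
    by (simp add: presented_group_def word_class_eq_iff word_eq_inverse)
  then show "\<exists>y\<in>carrier (presented_group R). y \<otimes>\<^bsub>presented_group R\<^esub> x = \<one>\<^bsub>presented_group R\<^esub>"
    by (auto simp: presented_group_def)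
next
  fix x assume "x \<in> carrier (presented_group R)"
  then obtain w where x: "x = word_class R w" by (auto simp: presented_group_def)
  have one: "\<one>\<^bsub>presented_group R\<^esub> = word_class R []" by (simp add: presented_group_def)
  show "\<one>\<^bsub>presented_group R\<^esub> \<otimes>\<^bsub>presented_group R\<^esub> x = x"
    unfolding x one presented_group_mult by simp
next
  fix x y
  assume "x \<in> carrier (presented_group R)" "y \<in> carrier (presented_group R)"
  then obtain v w where "x = word_class R v" "y = word_class R w"
    by (auto simp: presented_group_def)
  then have "x \<otimes>\<^bsub>presented_group R\<^esub> y = word_class R (v @ w)"
    by (simp only: presented_group_mult)
  then show "x \<otimes>\<^bsub>presented_group R\<^esub> y \<in> carrier (presented_group R)"
    by (simp add: presented_group_def)
next
  fix x y z
  assume "x \<in> carrier (presented_group R)" "y \<in> carrier (presented_group R)"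
    "z \<in> carrier (presented_group R)"
  then obtain u v w where "x = word_class R u" "y = word_class R v" "z = word_class R w"
    by (auto simp: presented_group_def)
  then show "x \<otimes>\<^bsub>presented_group R\<^esub> y \<otimes>\<^bsub>presented_group R\<^esub> z
      = x \<otimes>\<^bsub>presented_group R\<^esub> (y \<otimes>\<^bsub>presented_group R\<^esub> z)"
    by (simp only: presented_group_mult append_assoc)
qed (simp add: presented_group_def)

datatype xy = X | Y

text \<open>The relations \<open>x\<^bsup>p^(n-1)\<^esup> = 1\<close>, \<open>y\<^bsup>p\<^esup> = 1\<close>, \<open>y\<^bsup>-1\<^esup>xy = x\<^bsup>1 + p^(n-2)\<^esup>\<close>; meaningful for \<open>n \<ge> 2\<close>.\<close>

definition modular_group :: "nat \<Rightarrow> nat \<Rightarrow> xy word set monoid" where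
  "modular_group p n = presented_group
     {(replicate (p ^ (n - 1)) (X, True), []),
      (replicate p (Y, True), []),
      ([(Y, False), (X, True), (Y, True)], replicate (1 + p ^ (n - 2)) (X, True))}"

definition type2 :: "('a, 'm) monoid_scheme \<Rightarrow> nat \<Rightarrow> nat \<Rightarrow> bool" where
  "type2 G p n \<longleftrightarrow>
     prime p \<and> (p \<ge> 3 \<and> n \<ge> 3 \<or> p = 2 \<and> n \<ge> 4) \<and> G \<cong> modular_group p n"

end

theory Submission
  imports Defs
begin

text \<open>When \<open>gamma G = 1\<close>, any two non-normal subgroups are conjugate. A normal subgroup permutes with
  every subgroup, so two cyclic subgroups can only fail to permute if both belong to the single class
  of non-normal subgroups. Everything depends on whether the members of that class permute.

  In the modular group the element \<open>z = x\<^bsup>p^(n-2)\<^esup>\<close> is central and \<open>xy = z yx\<close>, so all commutators are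
  central (\<open>modular_group_class_two\<close>). A conjugate of a subgroup \<open>S\<close> then differs from \<open>S\<close> only by
  central factors, hence permutes with \<open>S\<close> (\<open>class_two_conjugates_permute\<close>). All subgroups permute
  and \<open>csd\<close> is constantly \<open>1\<close>.

  In \<open>G = NP\<close> with \<open>N\<close> normal of prime order \<open>p\<close> and \<open>P\<close> a cyclic complement, \<open>P\<close> cannot be normal, for
  otherwise \<open>G\<close> would be abelian and all its subgroups normal. So the non-normal subgroups are exactly
  the conjugates of \<open>P\<close>. As \<open>P\<close> is a maximal subgroup it is its own normalizer; therefore there are
  \<open>p\<close> conjugates, and no two different ones permute, since their product would be a subgroup above a
  maximal one, hence \<open>G\<close>, and a group is never the product of two conjugates of a
  proper subgroup. Let \<open>c\<close> and \<open>m\<close> be the numbers of cyclic subgroups of \<open>G\<close> and of \<open>P\<close>. Counting the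
  non-permuting pairs gives \<open>csd H G = 1 - (p - 1) / (m c)\<close> if \<open>H\<close> is a conjugate of \<open>P\<close>,
  \<open>csd G G = 1 - p (p - 1) / c\<^sup>2\<close>, and \<open>csd H G = 1\<close> for the remaining \<open>H\<close>, which contain no conjugate of \<open>P\<close>.
  The first two values coincide only if \<open>c = p m\<close>. This is impossible: a normal cyclic subgroup is either
  a proper subgroup \<open>L\<close> of \<open>P\<close> or of the form \<open>NL\<close> with such an \<open>L\<close>, so \<open>c \<le> p + 2 (m - 1)\<close>, and this
  is less than \<open>p m\<close> because \<open>p \<ge> 3\<close> and \<open>m \<ge> 2\<close>.\<close>

section \<open>Groups with one class of non-normal subgroups\<close>

lemma (in group) conjugate_eq_image:
  assumes "H \<subseteq> carrier G" "g \<in> carrier G"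
  shows "g <# H #> inv g = (\<lambda>x. g \<otimes> x \<otimes> inv g) ` H"
  using assms unfolding l_coset_def r_coset_def by auto

lemma (in group) nonnormal_subgroups_conjugate:
  assumes "gamma G = 1"
    and A: "subgroup A G" "\<not> A \<lhd> G" and B: "subgroup B G" "\<not> B \<lhd> G"
  shows "\<exists>g\<in>carrier G. B = g <# A #> inv g"
proof -
  let ?\<phi> = "\<lambda>g H. g <# H #> inv g" and ?E = "{H. subgroup H G \<and> \<not> H \<lhd> G}"
  obtain O' where "orbits G ?E ?\<phi> = {O'}"
    using assms(1) unfolding gamma_def by (auto simp: card_1_singleton_iff)
  then have "orbit G ?\<phi> A = orbit G ?\<phi> B"
    using A B unfolding orbits_def by blast
  moreover have "B \<in> orbit G ?\<phi> B"
  proof -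
    have "B = ?\<phi> \<one> B"
      using subgroup.subset[OF B(1)] by (simp add: lcos_mult_one)
    then show ?thesis unfolding orbit_def by blast
  qed
  ultimately have "B \<in> orbit G ?\<phi> A" by simp
  then show ?thesis unfolding orbit_def by auto
qed

lemma (in group) ex_nonnormal_subgroup:
  assumes "gamma G = 1"
  shows "\<exists>S. subgroup S G \<and> \<not> S \<lhd> G"
proof (rule ccontr)
  assume "\<not> ?thesis"
  then have empty: "{H. subgroup H G \<and> \<not> H \<lhd> G} = {}" by blast
  have "gamma G = 0" unfolding gamma_def empty by (simp add: orbits_def)
  with assms show False by simp
qed

lemma (in group) gamma_one_not_comm:
  assumes "gamma G = 1"
  shows "\<exists>a\<in>carrier G. \<exists>b\<in>carrier G. a \<otimes> b \<noteq> b \<otimes> a"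
proof (rule ccontr)
  assume "\<not> ?thesis"
  then have "comm_group G" by (intro group_comm_groupI) auto
  moreover obtain S where "subgroup S G" "\<not> S \<lhd> G" using ex_nonnormal_subgroup[OF assms] by blast
  ultimately show False using comm_group.normal_iff_subgroup by blast
qed

section \<open>Cyclic subgroups and the subgroup commutativity degree\<close>

lemma (in group) cyclic_subgroups_eq:
  "cyclic_subgroups G = (\<lambda>x. generate G {x}) ` carrier G"
proof -
  have cyc: "cyclic_group (G\<lparr>carrier := H\<rparr>) \<longleftrightarrow> (\<exists>x\<in>H. H = generate G {x})"
    if H: "subgroup H G" for H
  proof -
    have "range (\<lambda>n::int. x [^]\<^bsub>G\<lparr>carrier := H\<rparr>\<^esub> n) = generate G {x}" if "x \<in> H" for x
      using that int_pow_consistent[OF H that] subgroup.mem_carrier[OF H that]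
      by (auto simp: generate_pow)
    then show ?thesis
      using group.cyclic_group[OF subgroup.subgroup_is_group[OF H is_group]] by auto
  qed
  show ?thesis
  proof (intro equalityI subsetI)
    fix H assume "H \<in> cyclic_subgroups G"
    then have "subgroup H G" "\<exists>x\<in>H. H = generate G {x}"
      unfolding cyclic_subgroups_def using cyc by blast+
    then show "H \<in> (\<lambda>x. generate G {x}) ` carrier G"
      using subgroup.subset by blast
  next
    fix H assume "H \<in> (\<lambda>x. generate G {x}) ` carrier G"
    then obtain x where x: "x \<in> carrier G" "H = generate G {x}" by blast
    then have "subgroup H G" "x \<in> H"
      using generate_is_subgroup[of "{x}"] generate.incl[of x "{x}" G] by auto
    then show "H \<in> cyclic_subgroups G"
      unfolding cyclic_subgroups_def using cyc x(2) by blast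
  qed
qed

lemma (in group) cyclic_subgroups_restrict:
  assumes "subgroup H G"
  shows "cyclic_subgroups (G\<lparr>carrier := H\<rparr>) = {K \<in> cyclic_subgroups G. K \<subseteq> H}"
  unfolding cyclic_subgroups_def
  using subgroup_incl[OF _ assms] incl_subgroup[OF assms]
    subgroup.subset[of _ "G\<lparr>carrier := H\<rparr>"] by auto

text \<open>Sending an element to the subgroup that it generates makes cyclic subgroups easy to transport: along
  a homomorphism it suffices to move the generator.\<close>

lemma (in group) cyclic_subgroups_restrict_eq:
  assumes "subgroup H G"
  shows "cyclic_subgroups (G\<lparr>carrier := H\<rparr>) = (\<lambda>x. generate G {x}) ` H"
proof -
  have "generate G {x} \<subseteq> H \<longleftrightarrow> x \<in> H" for x
    using generate_subgroup_incl[of "{x}" H] generate.incl[of x "{x}" G] assms by blast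
  then show ?thesis
    unfolding cyclic_subgroups_restrict[OF assms] cyclic_subgroups_eq
    using subgroup.subset[OF assms] by blast
qed

text \<open>Few pairs fail to permute in the groups at hand, so the exceptional pairs are the ones to count.\<close>

lemma (in group) csd_eq_one_minus_nonpermuting:
  assumes fin: "finite (carrier G)" and H: "subgroup H G"
  shows "csd H G = 1 -
    real (card {(A, B) \<in> cyclic_subgroups (G\<lparr>carrier := H\<rparr>) \<times> cyclic_subgroups G. A <#> B \<noteq> B <#> A})
      / (real (card (cyclic_subgroups (G\<lparr>carrier := H\<rparr>))) * real (card (cyclic_subgroups G)))"
proof -
  let ?D = "cyclic_subgroups (G\<lparr>carrier := H\<rparr>)" and ?C = "cyclic_subgroups G"
  let ?g = "{(A, B) \<in> ?D \<times> ?C. A <#> B = B <#> A}"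
  let ?b = "{(A, B) \<in> ?D \<times> ?C. A <#> B \<noteq> B <#> A}"
  have fH: "finite H" using fin subgroup.subset[OF H] finite_subset by blast
  have D: "finite ?D" "?D \<noteq> {}"
    unfolding cyclic_subgroups_restrict_eq[OF H] using fH subgroup.one_closed[OF H] by auto
  have C: "finite ?C" "?C \<noteq> {}" unfolding cyclic_subgroups_eq using fin by auto
  have "?g \<union> ?b = ?D \<times> ?C" "?g \<inter> ?b = {}" by auto
  moreover have "finite ?g" "finite ?b"
    by (rule finite_subset[of _ "?D \<times> ?C"]; use D C in auto)+
  ultimately have "card ?g + card ?b = card ?D * card ?C"
    using card_Un_disjoint[of ?g ?b] card_cartesian_product[of ?D ?C] by simp
  from arg_cong[OF this, of real]
  have "real (card ?g) + real (card ?b) = real (card ?D) * real (card ?C)"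
    by (simp only: of_nat_add of_nat_mult)
  then have "real (card ?g) = real (card ?D) * real (card ?C) - real (card ?b)" by linarith
  moreover have "real (card ?D) * real (card ?C) \<noteq> 0" using C D by simp
  moreover have "1 / d * g = 1 - b / d" if "g = d - b" "d \<noteq> 0" for b d g :: real
    using that by (simp add: field_simps)
  ultimately show ?thesis unfolding csd_def by blast
qed

lemma (in group) card_cyclic_subgroups_conjugate:
  assumes H: "subgroup H G" and g: "g \<in> carrier G"
  shows "card (cyclic_subgroups (G\<lparr>carrier := g <# H #> inv g\<rparr>))
    = card (cyclic_subgroups (G\<lparr>carrier := H\<rparr>))"
proof -
  let ?f = "\<lambda>x. g \<otimes> x \<otimes> inv g"
  interpret f: group_hom G G ?f
    by unfold_locales (use g in \<open>auto simp: hom_def m_assoc inv_solve_left\<close>)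
  have gen: "generate G {?f x} = ?f ` generate G {x}" if "x \<in> H" for x
    using f.generate_img[of "{x}"] that subgroup.subset[OF H] by auto
  have "subgroup (g <# H #> inv g) G" using subgroup_conjugation_is_surj2[OF g H] .
  then have "cyclic_subgroups (G\<lparr>carrier := g <# H #> inv g\<rparr>)
      = (\<lambda>x. generate G {x}) ` ?f ` H"
    using cyclic_subgroups_restrict_eq conjugate_eq_image[OF subgroup.subset[OF H] g] by simp
  also have "\<dots> = (\<lambda>x. ?f ` generate G {x}) ` H"
    unfolding image_image using gen by (intro image_cong) auto
  also have "\<dots> = (`) ?f ` cyclic_subgroups (G\<lparr>carrier := H\<rparr>)"
    unfolding cyclic_subgroups_restrict_eq[OF H] image_image ..
  finally have eq: "cyclic_subgroups (G\<lparr>carrier := g <# H #> inv g\<rparr>) = \<dots>" .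
  have "inj_on ?f (carrier G)" using g by (auto intro!: inj_onI)
  then have "inj_on ((`) ?f) (Pow (carrier G))" by (rule inj_on_image_Pow)
  moreover have "cyclic_subgroups (G\<lparr>carrier := H\<rparr>) \<subseteq> Pow (carrier G)"
    unfolding cyclic_subgroups_restrict_eq[OF H]
    using generate_incl subgroup.subset[OF H] by blast
  ultimately show ?thesis unfolding eq
    by (intro card_image) (rule inj_on_subset)
qed

section \<open>Groups of nilpotency class at most two\<close>

lemma (in group) mult_inv_cancel:
  assumes "x \<in> carrier G" "y \<in> carrier G"
  shows "x \<otimes> (inv x \<otimes> y) = y" "inv x \<otimes> (x \<otimes> y) = y"
  using assms by (simp_all flip: m_assoc)

lemma (in group) inv_commutes:
  assumes "x \<in> carrier G" "y \<in> carrier G" "x \<otimes> y = y \<otimes> x"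
  shows "inv x \<otimes> y = y \<otimes> inv x"
proof -
  have "inv x \<otimes> y = inv x \<otimes> (y \<otimes> x) \<otimes> inv x" using assms(1,2) by (simp add: m_assoc)
  also have "\<dots> = inv x \<otimes> (x \<otimes> y) \<otimes> inv x" using assms(3) by simp
  also have "\<dots> = y \<otimes> inv x" using assms(1,2) by (simp add: mult_inv_cancel)
  finally show ?thesis .
qed

definition (in group) commute_mod_center :: "'a \<Rightarrow> 'a \<Rightarrow> bool" where
  "commute_mod_center a b \<longleftrightarrow>
     (\<exists>z\<in>carrier G. a \<otimes> b = z \<otimes> (b \<otimes> a) \<and> (\<forall>c\<in>carrier G. z \<otimes> c = c \<otimes> z))"

lemma (in group) commute_mod_centerE:
  assumes "commute_mod_center a b"
  obtains z where "z \<in> carrier G" "a \<otimes> b = z \<otimes> (b \<otimes> a)" "\<forall>c\<in>carrier G. c \<otimes> z = z \<otimes> c"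
  using assms unfolding commute_mod_center_def by metis

text \<open>If commutators are central, conjugating \<open>t\<close> by \<open>g\<close> multiplies it by a central \<open>z\<close>. Then
  \<open>s (z t) = (z t) (t\<^bsup>-1\<^esup> s t)\<close> moves an element of \<open>S\<close> past one of the conjugate of \<open>S\<close>, and
  \<open>(z t) s = (t s t\<^bsup>-1\<^esup>) (z t)\<close> moves it back.\<close>

lemma (in group) class_two_conjugates_permute:
  assumes class2: "\<And>a b. \<lbrakk>a \<in> carrier G; b \<in> carrier G\<rbrakk> \<Longrightarrow> commute_mod_center a b"
    and S: "subgroup S G" and g: "g \<in> carrier G"
  shows "S <#> (g <# S #> inv g) = (g <# S #> inv g) <#> S"
proof -
  let ?T = "g <# S #> inv g"
  have T: "?T = (\<lambda>x. g \<otimes> x \<otimes> inv g) ` S"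
    using conjugate_eq_image[OF subgroup.subset[OF S] g] .
  have central: "\<exists>z\<in>carrier G. g \<otimes> t \<otimes> inv g = z \<otimes> t \<and> (\<forall>c\<in>carrier G. c \<otimes> z = z \<otimes> c)"
    if t: "t \<in> carrier G" for t
  proof -
    obtain z where z: "z \<in> carrier G" "g \<otimes> t = z \<otimes> (t \<otimes> g)" "\<forall>c\<in>carrier G. c \<otimes> z = z \<otimes> c"
      using class2[OF g t] by (elim commute_mod_centerE)
    then have "g \<otimes> t \<otimes> inv g = z \<otimes> t" using t g by (simp add: m_assoc)
    with z show ?thesis by blast
  qed
  show ?thesis
  proof (intro equalityI subsetI)
    fix w assume "w \<in> S <#> ?T"
    then obtain s t where st: "s \<in> S" "t \<in> S" "w = s \<otimes> (g \<otimes> t \<otimes> inv g)"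
      unfolding set_mult_def T by blast
    then have c: "s \<in> carrier G" "t \<in> carrier G" using subgroup.mem_carrier[OF S] by auto
    obtain z where z: "z \<in> carrier G" "g \<otimes> t \<otimes> inv g = z \<otimes> t" "\<forall>c\<in>carrier G. c \<otimes> z = z \<otimes> c"
      using central[OF c(2)] by blast
    have "w = (s \<otimes> z) \<otimes> t" using st z(1,2) c by (simp add: m_assoc)
    also have "\<dots> = (z \<otimes> s) \<otimes> t" using z c by simp
    also have "\<dots> = (z \<otimes> t) \<otimes> (inv t \<otimes> s \<otimes> t)" using z(1) c by (simp add: m_assoc mult_inv_cancel)
    finally have "w = (g \<otimes> t \<otimes> inv g) \<otimes> (inv t \<otimes> s \<otimes> t)" using z(2) by simp
    moreover have "inv t \<otimes> s \<otimes> t \<in> S"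
      using st S by (simp add: subgroup.m_closed subgroup.m_inv_closed)
    ultimately show "w \<in> ?T <#> S" unfolding set_mult_def T using st(2) by blast
  next
    fix w assume "w \<in> ?T <#> S"
    then obtain s t where st: "s \<in> S" "t \<in> S" "w = (g \<otimes> t \<otimes> inv g) \<otimes> s"
      unfolding set_mult_def T by blast
    then have c: "s \<in> carrier G" "t \<in> carrier G" using subgroup.mem_carrier[OF S] by auto
    obtain z where z: "z \<in> carrier G" "g \<otimes> t \<otimes> inv g = z \<otimes> t" "\<forall>c\<in>carrier G. c \<otimes> z = z \<otimes> c"
      using central[OF c(2)] by blast
    have "w = z \<otimes> ((t \<otimes> s \<otimes> inv t) \<otimes> t)" using st z c by (simp add: m_assoc)
    also have "\<dots> = (z \<otimes> (t \<otimes> s \<otimes> inv t)) \<otimes> t" using z(1) c by (simp add: m_assoc)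
    also have "\<dots> = ((t \<otimes> s \<otimes> inv t) \<otimes> z) \<otimes> t" using z c by simp
    finally have "w = (t \<otimes> s \<otimes> inv t) \<otimes> (g \<otimes> t \<otimes> inv g)" using z(1,2) c by (simp add: m_assoc mult_inv_cancel)
    moreover have "t \<otimes> s \<otimes> inv t \<in> S"
      using st S by (simp add: subgroup.m_closed subgroup.m_inv_closed)
    ultimately show "w \<in> S <#> ?T" unfolding set_mult_def T using st(2) by blast
  qed
qed

lemma (in group) commute_mod_center_sym:
  assumes "a \<in> carrier G" "b \<in> carrier G" "commute_mod_center a b"
  shows "commute_mod_center b a"
proof -
  obtain z where z: "z \<in> carrier G" "a \<otimes> b = z \<otimes> (b \<otimes> a)" "\<forall>c\<in>carrier G. c \<otimes> z = z \<otimes> c"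
    using assms(3) by (elim commute_mod_centerE)
  have "b \<otimes> a = inv z \<otimes> (a \<otimes> b)" using z(1,2) assms by (simp add: inv_solve_left)
  moreover have "inv z \<otimes> c = c \<otimes> inv z" if "c \<in> carrier G" for c
    using inv_commutes[OF z(1) that] bspec[OF z(3) that] by simp
  ultimately show ?thesis unfolding commute_mod_center_def using z(1) by blast
qed

lemma (in group) commute_mod_center_generate:
  assumes b: "b \<in> carrier G" and S: "S \<subseteq> carrier G" "\<And>s. s \<in> S \<Longrightarrow> commute_mod_center s b"
    and a: "a \<in> generate G S"
  shows "commute_mod_center a b"
proof -
  have mult: "commute_mod_center (u \<otimes> v) b"
    if uv: "u \<in> carrier G" "v \<in> carrier G" "commute_mod_center u b" "commute_mod_center v b" for u v
  proof -
    obtain z where z: "z \<in> carrier G" "u \<otimes> b = z \<otimes> (b \<otimes> u)" "\<forall>c\<in>carrier G. c \<otimes> z = z \<otimes> c"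
      using uv(3) by (elim commute_mod_centerE)
    obtain w where w: "w \<in> carrier G" "v \<otimes> b = w \<otimes> (b \<otimes> v)" "\<forall>c\<in>carrier G. c \<otimes> w = w \<otimes> c"
      using uv(4) by (elim commute_mod_centerE)
    have "u \<otimes> v \<otimes> b = (u \<otimes> w) \<otimes> (b \<otimes> v)" using w(1,2) uv b by (simp add: m_assoc)
    also have "\<dots> = w \<otimes> ((u \<otimes> b) \<otimes> v)" using w(1,3) uv b by (simp add: m_assoc)
    also have "\<dots> = (w \<otimes> z) \<otimes> (b \<otimes> (u \<otimes> v))" using w(1) z(1,2) uv b by (simp add: m_assoc)
    finally have "u \<otimes> v \<otimes> b = (w \<otimes> z) \<otimes> (b \<otimes> (u \<otimes> v))" .
    moreover have "(w \<otimes> z) \<otimes> c = c \<otimes> (w \<otimes> z)" if "c \<in> carrier G" for c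
      using w(1) z(1) bspec[OF w(3) that] bspec[OF z(3) that] that by (metis m_assoc)
    ultimately show ?thesis unfolding commute_mod_center_def using w(1) z(1) by blast
  qed
  have inverse: "commute_mod_center (inv u) b" if u: "u \<in> carrier G" "commute_mod_center u b" for u
  proof -
    obtain z where z: "z \<in> carrier G" "b \<otimes> u = z \<otimes> (u \<otimes> b)" "\<forall>c\<in>carrier G. c \<otimes> z = z \<otimes> c"
      using commute_mod_center_sym[OF u(1) b u(2)] by (elim commute_mod_centerE)
    have "inv u \<otimes> b = inv u \<otimes> (b \<otimes> u) \<otimes> inv u" using u b by (simp add: m_assoc)
    also have "\<dots> = (inv u \<otimes> z) \<otimes> (u \<otimes> b) \<otimes> inv u" using z(1,2) u b by (simp add: m_assoc)
    also have "\<dots> = z \<otimes> (inv u \<otimes> (u \<otimes> (b \<otimes> inv u)))" using z(1,3) u b by (simp add: m_assoc)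
    also have "\<dots> = z \<otimes> (b \<otimes> inv u)" using u b z(1) by (simp flip: m_assoc)
    finally show ?thesis unfolding commute_mod_center_def using z(1,3) by metis
  qed
  show ?thesis using a
  proof induction
    case one
    then show ?case unfolding commute_mod_center_def using b by (intro bexI[of _ \<one>]) auto
  next
    case (incl h) then show ?case using S by blast
  next
    case (inv h) then show ?case using S inverse by blast
  next
    case (eng h1 h2) then show ?case using mult generate_in_carrier[OF S(1)] by blast
  qed
qed

text \<open>Modulo the center the group is generated by two commuting elements, hence abelian: fix one argument
  at a generator to extend the other to the whole group, then exchange the roles.\<close>

lemma (in group) class_two_if_generators_commute_mod_center:
  assumes x: "x \<in> carrier G" and y: "y \<in> carrier G" and gen: "carrier G = generate G {x, y}"
    and xy: "commute_mod_center x y" and a: "a \<in> carrier G" and b: "b \<in> carrier G"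
  shows "commute_mod_center a b"
proof -
  have refl: "commute_mod_center c c" if "c \<in> carrier G" for c
    unfolding commute_mod_center_def using that by (intro bexI[of _ \<one>]) auto
  have *: "commute_mod_center c s" if "c \<in> carrier G" "s \<in> {x, y}" for c s
  proof (rule commute_mod_center_generate)
    show "c \<in> generate G {x, y}" using that gen by simp
    show "commute_mod_center t s" if "t \<in> {x, y}" for t
      using that \<open>s \<in> {x, y}\<close> refl x y xy commute_mod_center_sym by blast
  qed (use x y that in auto)
  show ?thesis
  proof (rule commute_mod_center_generate)
    show "a \<in> generate G {x, y}" using a gen by simp
    show "commute_mod_center t b" if "t \<in> {x, y}" for t
      using commute_mod_center_sym[OF b _ *[OF b that]] that x y by blast
  qed (use x y b in auto)
qed

lemma (in group) commutes_with_generate: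
  assumes z: "z \<in> carrier G" and S: "S \<subseteq> carrier G" "\<And>s. s \<in> S \<Longrightarrow> z \<otimes> s = s \<otimes> z"
    and c: "c \<in> generate G S"
  shows "z \<otimes> c = c \<otimes> z"
  using c
proof induction
  case one then show ?case using z by simp
next
  case (incl h) then show ?case using S by blast
next
  case (inv h)
  then have h: "h \<in> carrier G" "h \<otimes> z = z \<otimes> h" using S by auto
  show ?case using inv_commutes[OF h(1) z h(2)] by simp
next
  case (eng h1 h2)
  then have "h1 \<in> carrier G" "h2 \<in> carrier G" using generate_in_carrier[OF S(1)] by auto
  then show ?case using eng z by (metis m_assoc)
qed

lemma (in group) conjugate_nat_pow:
  assumes "x \<in> carrier G" "y \<in> carrier G"
  shows "inv y \<otimes> (x [^] (k::nat)) \<otimes> y = (inv y \<otimes> x \<otimes> y) [^] k"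
proof (induction k)
  case 0 then show ?case using assms by simp
next
  case (Suc k)
  have "inv y \<otimes> (x [^] Suc k) \<otimes> y = (inv y \<otimes> x [^] k \<otimes> y) \<otimes> (inv y \<otimes> x \<otimes> y)"
    using assms by (simp add: m_assoc mult_inv_cancel)
  then show ?case using Suc by simp
qed

text \<open>The element \<open>x\<^sup>r\<close> relates \<open>xy\<close> to \<open>yx\<close>. Conjugation by \<open>y\<close> sends it to \<open>x\<^sup>r x\<^bsup>r\<cdot>r\<^esup> = x\<^sup>r\<close>, so it commutes
  with both generators and is central.\<close>

lemma (in group) metacyclic_class_two:
  assumes x: "x \<in> carrier G" and y: "y \<in> carrier G" and gen: "carrier G = generate G {x, y}"
    and conj: "inv y \<otimes> x \<otimes> y = x [^] (1 + r :: nat)" and r: "x [^] (r * r) = \<one>"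
    and ab: "a \<in> carrier G" "b \<in> carrier G"
  shows "commute_mod_center a b"
proof -
  let ?z = "x [^] r"
  have z: "?z \<in> carrier G" using x by simp
  have "inv y \<otimes> ?z \<otimes> y = x [^] ((1 + r) * r)"
    unfolding conjugate_nat_pow[OF x y] conj by (rule nat_pow_pow[OF x])
  also have "(1 + r) * r = r + r * r" by simp
  also have "x [^] (r + r * r) = ?z" using r x nat_pow_mult[OF x, of r "r * r"] by simp
  finally have zy: "?z \<otimes> y = y \<otimes> ?z" using x y z by (simp add: m_assoc inv_solve_left')
  have zx: "?z \<otimes> x = x \<otimes> ?z" using x nat_pow_comm[OF x, of r 1] by simp
  have central: "?z \<otimes> c = c \<otimes> ?z" if "c \<in> carrier G" for c
    using commutes_with_generate[OF z, of "{x, y}" c] zx zy x y that gen by blast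
  have "x \<otimes> y = y \<otimes> x [^] (1 + r)"
    using conj x y by (metis inv_closed inv_solve_left m_assoc m_closed nat_pow_closed)
  also have "\<dots> = (y \<otimes> x) \<otimes> ?z"
    using x y nat_pow_mult[OF x, of 1 r] by (simp add: m_assoc)
  also have "\<dots> = ?z \<otimes> (y \<otimes> x)" using central x y by simp
  finally have "commute_mod_center x y"
    unfolding commute_mod_center_def using z central by blast
  then show ?thesis
    using class_two_if_generators_commute_mod_center[OF x y gen] ab by blast
qed

section \<open>The modular group\<close>

lemma modular_group_class_two:
  assumes n: "n \<ge> 3" and ab: "a \<in> carrier (modular_group p n)" "b \<in> carrier (modular_group p n)"
  shows "group.commute_mod_center (modular_group p n) a b"
proof -
  define R where "R = {(replicate (p ^ (n - 1)) (X, True), []),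
      (replicate p (Y, True), []),
      ([(Y, False), (X, True), (Y, True)], replicate (1 + p ^ (n - 2)) (X, True))}"
  define M where "M = presented_group R"
  have M: "modular_group p n = M" unfolding M_def R_def modular_group_def ..
  interpret group M unfolding M_def by (rule group_presented_group)
  let ?c = "word_class R"
  have carrier: "carrier M = range ?c" and one: "\<one>\<^bsub>M\<^esub> = ?c []"
    and mult: "\<And>v w. ?c v \<otimes>\<^bsub>M\<^esub> ?c w = ?c (v @ w)"
    unfolding M_def presented_group_mult by (simp_all add: presented_group_def)
  have rel: "?c l = ?c r" if "(l, r) \<in> R" for l r
    using word_eq.relation[OF that, of "[]" "[]"] by (simp add: word_class_eq_iff)
  have rel_x: "?c (replicate (p ^ (n - 1)) (X, True)) = ?c []"
    and rel_xy: "?c [(Y, False), (X, True), (Y, True)] = ?c (replicate (1 + p ^ (n - 2)) (X, True))"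
    by (rule rel; simp only: R_def insert_iff simp_thms)+
  have inv: "inv\<^bsub>M\<^esub> (?c [(g, True)]) = ?c [(g, False)]" for g
  proof (rule inv_equality)
    show "?c [(g, False)] \<otimes>\<^bsub>M\<^esub> ?c [(g, True)] = \<one>\<^bsub>M\<^esub>"
      using word_eq.cancel[of R "[]" g False "[]"] by (simp add: mult one word_class_eq_iff)
  qed (simp_all add: carrier)
  define x y where "x = ?c [(X, True)]" and "y = ?c [(Y, True)]"
  have x: "x \<in> carrier M" and y: "y \<in> carrier M" unfolding x_def y_def carrier by simp_all
  have pow: "x [^]\<^bsub>M\<^esub> k = ?c (replicate k (X, True))" for k :: nat
    by (induction k) (simp_all add: one mult x_def replicate_append_same)
  have "?c w \<in> generate M {x, y}" for w
  proof (induction w)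
    case Nil show ?case using generate.one[of M] by (simp add: one)
  next
    case (Cons l w)
    obtain g s where l: "l = (g, s)" by force
    have "?c [(g, True)] \<in> {x, y}" unfolding x_def y_def by (cases g) auto
    then have "?c [l] \<in> generate M {x, y}"
      unfolding l using generate.incl[of "?c [(g, True)]" "{x, y}" M]
        generate.inv[of "?c [(g, True)]" "{x, y}" M] inv[of g] by (cases s) simp_all
    with Cons have "?c [l] \<otimes>\<^bsub>M\<^esub> ?c w \<in> generate M {x, y}" by (intro generate.eng)
    then show ?case by (simp add: mult)
  qed
  then have "carrier M \<subseteq> generate M {x, y}" unfolding carrier by (rule image_subsetI)
  moreover have "generate M {x, y} \<subseteq> carrier M" using x y by (intro generate_incl) simp
  ultimately have gen: "carrier M = generate M {x, y}" by (rule equalityI)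
  let ?r = "p ^ (n - 2)"
  have conj: "inv\<^bsub>M\<^esub> y \<otimes>\<^bsub>M\<^esub> x \<otimes>\<^bsub>M\<^esub> y = x [^]\<^bsub>M\<^esub> (1 + ?r)"
    unfolding pow rel_xy[symmetric] by (simp add: x_def y_def inv mult)
  \<comment> \<open>Here \<open>n \<ge> 3\<close> matters: it makes \<open>2 (n - 2)\<close> at least \<open>n - 1\<close>, so \<open>x\<^bsup>r\<cdot>r\<^esup> = 1\<close>.\<close>
  have "x [^]\<^bsub>M\<^esub> (p ^ (n - 1)) = \<one>\<^bsub>M\<^esub>" unfolding pow one by (rule rel_x)
  moreover have "?r * ?r = p ^ (n - 1) * p ^ (n - 3)"
    using n by (simp flip: power_add)
  ultimately have "x [^]\<^bsub>M\<^esub> (?r * ?r) = \<one>\<^bsub>M\<^esub>"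
    using nat_pow_pow[OF x, of "p ^ (n - 1)" "p ^ (n - 3)"] by simp
  then show ?thesis
    using metacyclic_class_two[OF x y gen conj] ab unfolding M by blast
qed

lemma (in group) commute_mod_center_iso:
  assumes h: "h \<in> iso G K" and K: "group K" and a: "a \<in> carrier G" and b: "b \<in> carrier G"
    and hab: "group.commute_mod_center K (h a) (h b)"
  shows "commute_mod_center a b"
proof -
  interpret K: group K by (rule K)
  interpret h: group_hom G K h
    by unfold_locales (use h in \<open>simp add: iso_def\<close>)
  have inj: "inj_on h (carrier G)" and surj: "h ` carrier G = carrier K"
    using h by (auto simp: iso_def bij_betw_def)
  obtain w where w: "w \<in> carrier K" "h a \<otimes>\<^bsub>K\<^esub> h b = w \<otimes>\<^bsub>K\<^esub> (h b \<otimes>\<^bsub>K\<^esub> h a)"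
    "\<forall>c\<in>carrier K. c \<otimes>\<^bsub>K\<^esub> w = w \<otimes>\<^bsub>K\<^esub> c"
    using hab by (elim K.commute_mod_centerE)
  then obtain z where z: "z \<in> carrier G" "w = h z" using surj by blast
  have "h (a \<otimes> b) = h (z \<otimes> (b \<otimes> a))" using w(2) z a b by simp
  then have "a \<otimes> b = z \<otimes> (b \<otimes> a)" using inj_onD[OF inj] z(1) a b by simp
  moreover have "z \<otimes> c = c \<otimes> z" if c: "c \<in> carrier G" for c
  proof -
    have "h (z \<otimes> c) = h (c \<otimes> z)" using bspec[OF w(3), of "h c"] z c by simp
    then show ?thesis using inj_onD[OF inj] z(1) c by simp
  qed
  ultimately show ?thesis unfolding commute_mod_center_def using z(1) by blast
qed

lemma (in group) type2_Im_f1: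
  assumes fin: "finite (carrier G)" and gamma: "gamma G = 1" and t: "type2 G p n"
  shows "Im_f1 G = {1}"
proof -
  have n: "n \<ge> 3" and iso: "G \<cong> modular_group p n" using t unfolding type2_def by auto
  then obtain h where h: "h \<in> iso G (modular_group p n)" unfolding is_iso_def by blast
  have K: "group (modular_group p n)" unfolding modular_group_def by (rule group_presented_group)
  have class2: "commute_mod_center a b" if "a \<in> carrier G" "b \<in> carrier G" for a b
  proof (rule commute_mod_center_iso[OF h K that])
    have "h a \<in> carrier (modular_group p n)" "h b \<in> carrier (modular_group p n)"
      using h that by (auto simp: iso_def hom_def)
    then show "group.commute_mod_center (modular_group p n) (h a) (h b)"
      by (rule modular_group_class_two[OF n])
  qed
  have perm: "A <#> B = B <#> A" if A: "subgroup A G" and B: "subgroup B G" for A B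
  proof (cases "A \<lhd> G \<or> B \<lhd> G")
    case True
    then show ?thesis using commut_normal[OF A] commut_normal[OF B] by metis
  next
    case False
    then obtain g where "g \<in> carrier G" "B = g <# A #> inv g"
      using nonnormal_subgroups_conjugate[OF gamma A _ B] by blast
    then show ?thesis using class_two_conjugates_permute[OF class2 A] by blast
  qed
  have "csd H G = 1" if H: "subgroup H G" for H
  proof -
    have "{(A, B) \<in> cyclic_subgroups (G\<lparr>carrier := H\<rparr>) \<times> cyclic_subgroups G. A <#> B \<noteq> B <#> A} = {}"
      unfolding cyclic_subgroups_restrict[OF H] using perm unfolding cyclic_subgroups_def by blast
    then show ?thesis unfolding csd_eq_one_minus_nonpermuting[OF fin H] by (simp only: card.empty)
  qed
  moreover have "subgroup (carrier G) G" by (rule subgroup_self)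
  ultimately show ?thesis unfolding Im_f1_def subgroups_def by auto
qed

section \<open>A cyclic complement to a normal subgroup of prime order\<close>

text \<open>The quotient by \<open>A\<close> is an image of the commutative set \<open>U\<close>, so commutators lie in \<open>A\<close>.\<close>

lemma (in group) commutator_in_normal_subgroup:
  assumes A: "A \<lhd> G" and U: "U \<subseteq> carrier G" "A <#> U = carrier G"
    and comm: "\<And>u v. \<lbrakk>u \<in> U; v \<in> U\<rbrakk> \<Longrightarrow> u \<otimes> v = v \<otimes> u"
    and g: "g \<in> carrier G" and h: "h \<in> carrier G"
  shows "\<exists>a\<in>A. g \<otimes> h = a \<otimes> (h \<otimes> g)"
proof -
  have sub: "subgroup A G" by (rule normal_imp_subgroup[OF A])
  have rep: "\<exists>u\<in>U. A #> x = A #> u" if "x \<in> carrier G" for x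
  proof -
    have "x \<in> A <#> U" unfolding U(2) by (rule that)
    then obtain a u where au: "a \<in> A" "u \<in> U" "x = a \<otimes> u"
      unfolding set_mult_def by blast
    then have c: "a \<in> carrier G" "u \<in> carrier G" using subgroup.mem_carrier[OF sub] U(1) by auto
    have "A #> x = (A #> a) #> u"
      using coset_mult_assoc[OF subgroup.subset[OF sub] c] au(3) by simp
    also have "A #> a = A" by (rule coset_join2[OF c(1) sub au(1)])
    finally show ?thesis using au(2) by blast
  qed
  obtain u where u: "u \<in> U" "A #> g = A #> u" using rep[OF g] by (rule bexE)
  obtain v where v: "v \<in> U" "A #> h = A #> v" using rep[OF h] by (rule bexE)
  have c: "u \<in> carrier G" "v \<in> carrier G" using u(1) v(1) U(1) by auto
  have "A #> (g \<otimes> h) = A #> (u \<otimes> v)"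
    using normal.rcos_sum[OF A g h] normal.rcos_sum[OF A c] u v by simp
  also have "\<dots> = A #> (h \<otimes> g)"
    using normal.rcos_sum[OF A h g] normal.rcos_sum[OF A c(2,1)] u v comm[OF u(1) v(1)] by simp
  finally have "g \<otimes> h \<in> A #> (h \<otimes> g)" using rcos_self[of "g \<otimes> h" A] g h sub by simp
  then show ?thesis unfolding r_coset_def by blast
qed

lemma (in group) comm_if_abelian_quotients:
  assumes A: "A \<lhd> G" "U \<subseteq> carrier G" "A <#> U = carrier G"
      "\<And>u v. \<lbrakk>u \<in> U; v \<in> U\<rbrakk> \<Longrightarrow> u \<otimes> v = v \<otimes> u"
    and B: "B \<lhd> G" "V \<subseteq> carrier G" "B <#> V = carrier G"
      "\<And>u v. \<lbrakk>u \<in> V; v \<in> V\<rbrakk> \<Longrightarrow> u \<otimes> v = v \<otimes> u"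
    and AB: "A \<inter> B = {\<one>}" and gh: "g \<in> carrier G" "h \<in> carrier G"
  shows "g \<otimes> h = h \<otimes> g"
proof -
  obtain a where a: "a \<in> A" "g \<otimes> h = a \<otimes> (h \<otimes> g)"
    using commutator_in_normal_subgroup[OF A gh] by blast
  obtain b where b: "b \<in> B" "g \<otimes> h = b \<otimes> (h \<otimes> g)"
    using commutator_in_normal_subgroup[OF B gh] by blast
  have c: "a \<in> carrier G" "b \<in> carrier G"
    using subgroup.mem_carrier[OF normal_imp_subgroup[OF A(1)] a(1)]
      subgroup.mem_carrier[OF normal_imp_subgroup[OF B(1)] b(1)] by simp_all
  have "a = b" using a(2) b(2) c gh by simp
  then have "a = \<one>" using a(1) b(1) AB by blast
  then show ?thesis using a(2) gh by simp
qed

lemma (in group) cyclic_subgroup_comm: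
  assumes "K \<in> cyclic_subgroups G" "a \<in> K" "b \<in> K"
  shows "a \<otimes> b = b \<otimes> a"
proof -
  have "subgroup K G" "cyclic_group (G\<lparr>carrier := K\<rparr>)"
    using assms(1) unfolding cyclic_subgroups_def by auto
  then have "comm_group (G\<lparr>carrier := K\<rparr>)"
    using group.cyclic_imp_abelian_group subgroup.subgroup_is_group is_group by blast
  then show ?thesis using comm_groupE(4)[of "G\<lparr>carrier := K\<rparr>" a b] assms by simp
qed

lemma (in group) subgroup_of_prime_order:
  assumes N: "subgroup N G" "prime (card N)" and A: "subgroup A G" "A \<subseteq> N"
  shows "A = {\<one>} \<or> A = N"
proof -
  interpret N: group "G\<lparr>carrier := N\<rparr>" by (rule subgroup.subgroup_is_group[OF N(1) is_group])
  have finN: "finite N" using N(2) card_ge_0_finite prime_gt_0_nat by blast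
  have "card A dvd card N"
    using N.lagrange[OF subgroup_incl[OF A(1) N(1) A(2)]] by (simp add: order_def) (metis dvd_triv_right)
  then have "card A = 1 \<or> card A = card N" using N(2) prime_nat_iff by blast
  then show ?thesis
  proof
    assume "card A = 1"
    then obtain a where "A = {a}" by (auto simp: card_1_singleton_iff)
    then show ?thesis using subgroup.one_closed[OF A(1)] by simp
  next
    assume "card A = card N"
    then show ?thesis using card_subset_eq[OF finN A(2)] by simp
  qed
qed

lemma (in group) prime_order_subgroup_cyclic:
  assumes N: "subgroup N G" "prime (card N)"
  shows "N \<in> cyclic_subgroups G"
proof -
  have "N \<noteq> {\<one>}" using N(2) by auto
  then obtain x where x: "x \<in> N" "x \<noteq> \<one>" using subgroup.one_closed[OF N(1)] by blast
  have xG: "x \<in> carrier G" using subgroup.mem_carrier[OF N(1) x(1)] .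
  have "subgroup (generate G {x}) G" by (rule generate_is_subgroup) (use xG in simp)
  moreover have "generate G {x} \<subseteq> N" by (rule generate_subgroup_incl[OF _ N(1)]) (use x in simp)
  ultimately have "generate G {x} = {\<one>} \<or> generate G {x} = N"
    by (rule subgroup_of_prime_order[OF N])
  moreover have "x \<in> generate G {x}" by (rule generate.incl) simp
  ultimately have "generate G {x} = N" using x(2) by blast
  then show ?thesis unfolding cyclic_subgroups_eq using xG by blast
qed

lemma (in group) commuting_product_subgroup:
  assumes A: "subgroup A G" and B: "subgroup B G" and AB: "A <#> B = B <#> A"
  shows "subgroup (A <#> B) G"
proof (rule subgroupI)
  show "A <#> B \<subseteq> carrier G" using A B by (intro set_mult_closed subgroup.subset)
  have "\<one> \<otimes> \<one> \<in> A <#> B"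
    unfolding set_mult_def using subgroup.one_closed[OF A] subgroup.one_closed[OF B] by blast
  then show "A <#> B \<noteq> {}" by blast
next
  fix x assume "x \<in> A <#> B"
  then obtain a b where ab: "a \<in> A" "b \<in> B" "x = a \<otimes> b" unfolding set_mult_def by blast
  then have "inv x = inv b \<otimes> inv a"
    using subgroup.mem_carrier[OF A] subgroup.mem_carrier[OF B] by (simp add: inv_mult_group)
  then have "inv x \<in> B <#> A" unfolding set_mult_def
    using subgroup.m_inv_closed[OF A ab(1)] subgroup.m_inv_closed[OF B ab(2)] by blast
  then show "inv x \<in> A <#> B" using AB by simp
next
  fix x y assume x: "x \<in> A <#> B" and y: "y \<in> A <#> B"
  obtain a b where ab: "a \<in> A" "b \<in> B" "x = a \<otimes> b" using x unfolding set_mult_def by blast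
  obtain c d where cd: "c \<in> A" "d \<in> B" "y = c \<otimes> d" using y unfolding set_mult_def by blast
  have "b \<otimes> c \<in> A <#> B" unfolding AB using ab cd unfolding set_mult_def by blast
  then obtain e f where ef: "e \<in> A" "f \<in> B" "b \<otimes> c = e \<otimes> f" unfolding set_mult_def by blast
  note carr = subgroup.mem_carrier[OF A] subgroup.mem_carrier[OF B]
  have "x \<otimes> y = a \<otimes> (b \<otimes> c) \<otimes> d" using ab cd carr by (simp add: m_assoc)
  also have "\<dots> = (a \<otimes> e) \<otimes> (f \<otimes> d)" using ab cd ef carr by (simp add: m_assoc)
  finally show "x \<otimes> y \<in> A <#> B" unfolding set_mult_def
    using subgroup.m_closed[OF A ab(1) ef(1)] subgroup.m_closed[OF B ef(2) cd(2)] by blast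
qed

lemma (in group) card_conjugate:
  assumes "H \<subseteq> carrier G" "g \<in> carrier G"
  shows "card (g <# H #> inv g) = card H"
proof -
  have "inj_on (\<lambda>x. g \<otimes> x \<otimes> inv g) (carrier G)" using assms(2) by (auto intro!: inj_onI)
  then show ?thesis
    unfolding conjugate_eq_image[OF assms] using assms(1) by (intro card_image) (rule inj_on_subset)
qed

lemma (in group) conjugate_generate:
  assumes "g \<in> carrier G" "x \<in> carrier G"
  shows "g <# generate G {x} #> inv g = generate G {g \<otimes> x \<otimes> inv g}"
proof -
  interpret f: group_hom G G "\<lambda>x. g \<otimes> x \<otimes> inv g"
    by unfold_locales (use assms in \<open>auto simp: hom_def m_assoc mult_inv_cancel\<close>)
  show ?thesis
    using f.generate_img[of "{x}"] conjugate_eq_image[OF generate_incl assms(1), of "{x}"] assms by simp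
qed

text \<open>Writing \<open>g\<^bsup>-1\<^esup> = u (g w g\<^bsup>-1\<^esup>)\<close> with \<open>u, w \<in> A\<close> and cancelling gives \<open>u g w = 1\<close>. Consequently a group is
  never the product of two conjugates of a proper subgroup.\<close>

lemma (in group) mem_if_product_conjugate_eq_carrier:
  assumes A: "subgroup A G" and g: "g \<in> carrier G" and eq: "A <#> (g <# A #> inv g) = carrier G"
  shows "g \<in> A"
proof -
  have "inv g \<in> A <#> (g <# A #> inv g)" using eq g by simp
  then obtain u w where uw: "u \<in> A" "w \<in> A" "inv g = u \<otimes> (g \<otimes> w \<otimes> inv g)"
    unfolding conjugate_eq_image[OF subgroup.subset[OF A] g] set_mult_def by blast
  then have c: "u \<in> carrier G" "w \<in> carrier G" using subgroup.mem_carrier[OF A] by auto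
  have "inv g \<otimes> g = (u \<otimes> (g \<otimes> w \<otimes> inv g)) \<otimes> g" by (rule arg_cong[OF uw(3)])
  then have ugw: "u \<otimes> (g \<otimes> w) = \<one>" using c g by (simp add: m_assoc)
  have "g = inv u \<otimes> (u \<otimes> (g \<otimes> w)) \<otimes> inv w" using c g by (simp add: m_assoc mult_inv_cancel)
  then have "g = inv u \<otimes> inv w" using ugw c by simp
  then show ?thesis using uw subgroup.m_closed[OF A] subgroup.m_inv_closed[OF A] by simp
qed

text \<open>In the semidirect products, the bound on \<open>card N\<close> comes from \<open>q dvd p - 1\<close>.\<close>

locale prime_by_cyclic = group G for G (structure) +
  fixes N P
  assumes fin: "finite (carrier G)" and gamma_one: "gamma G = 1"
    and N_normal: "N \<lhd> G" and prime_N: "prime (card N)" and card_N: "card N \<ge> 3"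
    and P_cyclic: "P \<in> cyclic_subgroups G"
    and NP: "N <#> P = carrier G" and N_Int_P: "N \<inter> P = {\<one>}"
begin

lemma P: "subgroup P G" and N: "subgroup N G"
  using P_cyclic normal_imp_subgroup[OF N_normal] unfolding cyclic_subgroups_def by auto

lemmas P_subset = subgroup.subset[OF P] and N_subset = subgroup.subset[OF N]

lemma P_not_normal: "\<not> P \<lhd> G"
proof
  assume PN: "P \<lhd> G"
  have PN': "P <#> N = carrier G" using commut_normal[OF P N_normal] NP by simp
  have "a \<otimes> b = b \<otimes> a" if "a \<in> carrier G" "b \<in> carrier G" for a b
    using comm_if_abelian_quotients[OF N_normal P_subset NP cyclic_subgroup_comm[OF P_cyclic]
        PN N_subset PN' cyclic_subgroup_comm[OF prime_order_subgroup_cyclic[OF N prime_N]] N_Int_P that]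
    by blast
  then show False using gamma_one_not_comm[OF gamma_one] by blast
qed

text \<open>\<open>P\<close> is maximal: for a subgroup \<open>U\<close> above \<open>P\<close>, the trace \<open>U \<inter> N\<close> is trivial or all of \<open>N\<close>, and
  \<open>G = NP\<close> then forces \<open>U = P\<close> or \<open>U = G\<close>.\<close>

lemma subgroup_above_P:
  assumes U: "subgroup U G" "P \<subseteq> U"
  shows "U = P \<or> U = carrier G"
proof -
  have "subgroup (U \<inter> N) G" by (rule subgroups_Inter_pair[OF U(1) N])
  then have "U \<inter> N = {\<one>} \<or> U \<inter> N = N"
    by (rule subgroup_of_prime_order[OF N prime_N]) blast
  then show ?thesis
  proof
    assume 1: "U \<inter> N = {\<one>}"
    have "u \<in> P" if u: "u \<in> U" for u
    proof -
      have "u \<in> N <#> P" unfolding NP using subgroup.mem_carrier[OF U(1) u] .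
      then obtain n v where nv: "n \<in> N" "v \<in> P" "u = n \<otimes> v" unfolding set_mult_def by blast
      then have c: "n \<in> carrier G" "v \<in> carrier G" using N_subset P_subset by auto
      have "n = u \<otimes> inv v" using nv(3) c by (simp add: m_assoc)
      moreover have "v \<in> U" using nv(2) U(2) by blast
      ultimately have "n \<in> U" using subgroup.m_closed[OF U(1) u] subgroup.m_inv_closed[OF U(1)] by simp
      then have "n = \<one>" using nv(1) 1 by blast
      then show ?thesis using nv c by simp
    qed
    then show ?thesis using U(2) by blast
  next
    assume "U \<inter> N = N"
    then have "N <#> P \<subseteq> U <#> U" by (intro mono_set_mult U(2)) blast
    also have "\<dots> = U" by (rule subgroup_mult_id[OF U(1)])
    finally have "carrier G \<subseteq> U" unfolding NP .
    then show ?thesis using subgroup.subset[OF U(1)] by blast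
  qed
qed

definition conjugates :: "'a set set" where
  "conjugates = (\<lambda>g. g <# P #> inv g) ` carrier G"

lemma conjugates_subgroup: "A \<in> conjugates \<Longrightarrow> subgroup A G"
  unfolding conjugates_def using subgroup_conjugation_is_surj2[OF _ P] by blast

lemma conjugates_card: "A \<in> conjugates \<Longrightarrow> card A = card P"
  unfolding conjugates_def using card_conjugate[OF P_subset] by blast

lemma finite_subset_carrier: "A \<subseteq> carrier G \<Longrightarrow> finite A"
  using fin finite_subset by blast

lemma conjugates_eqI:
  assumes "A \<in> conjugates" "B \<in> conjugates" "A \<subseteq> B"
  shows "A = B"
  by (rule card_subset_eq[OF finite_subset_carrier])
    (use assms conjugates_card subgroup.subset[OF conjugates_subgroup] in auto)

lemma P_in_conjugates: "P \<in> conjugates"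
proof -
  have "P = \<one> <# P #> inv \<one>" using P_subset by (simp add: lcos_mult_one)
  then show ?thesis unfolding conjugates_def by blast
qed

text \<open>A normal conjugate of \<open>P\<close> would contain \<open>P\<close>, and so equal it by cardinality. The converse is the
  hypothesis on \<open>gamma\<close>.\<close>

lemma conjugates_iff:
  assumes A: "subgroup A G"
  shows "A \<in> conjugates \<longleftrightarrow> \<not> A \<lhd> G"
proof
  assume conj: "A \<in> conjugates"
  then obtain g where g: "g \<in> carrier G" "A = g <# P #> inv g" unfolding conjugates_def by blast
  show "\<not> A \<lhd> G"
  proof
    assume norm: "A \<lhd> G"
    have "P \<subseteq> A"
    proof
      fix x assume x: "x \<in> P"
      then have xG: "x \<in> carrier G" using P_subset by blast
      have "g \<otimes> x \<otimes> inv g \<in> A" unfolding g(2) conjugate_eq_image[OF P_subset g(1)] using x by blast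
      then have "inv g \<otimes> (g \<otimes> x \<otimes> inv g) \<otimes> inv (inv g) \<in> A"
        using norm g(1) inv_closed unfolding normal_inv_iff by blast
      then show "x \<in> A" using xG g(1) by (simp add: m_assoc mult_inv_cancel)
    qed
    then have "P = A" using conjugates_eqI[OF P_in_conjugates conj] by blast
    then show False using norm P_not_normal by blast
  qed
next
  assume "\<not> A \<lhd> G"
  then show "A \<in> conjugates"
    unfolding conjugates_def
    using nonnormal_subgroups_conjugate[OF gamma_one P P_not_normal A] by blast
qed

lemma subgroup_above_conjugate:
  assumes A: "A \<in> conjugates" and U: "subgroup U G" "A \<subseteq> U"
  shows "U = A \<or> U = carrier G"
proof -
  obtain g where g: "g \<in> carrier G" "A = g <# P #> inv g" using A unfolding conjugates_def by blast
  let ?U = "inv g <# U #> inv (inv g)"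
  have "P \<subseteq> ?U"
  proof
    fix x assume x: "x \<in> P"
    then have xG: "x \<in> carrier G" using P_subset by blast
    have "g \<otimes> x \<otimes> inv g \<in> U" using U(2) x unfolding g(2) conjugate_eq_image[OF P_subset g(1)] by blast
    then have "inv g \<otimes> (g \<otimes> x \<otimes> inv g) \<otimes> inv (inv g) \<in> ?U"
      unfolding conjugate_eq_image[OF subgroup.subset[OF U(1)] inv_closed[OF g(1)]] by blast
    then show "x \<in> ?U" using xG g(1) by (simp add: m_assoc mult_inv_cancel)
  qed
  then have "?U = P \<or> ?U = carrier G"
    by (rule subgroup_above_P[OF subgroup_conjugation_is_surj2[OF inv_closed[OF g(1)] U(1)]])
  then have "card U = card A \<or> card U = card (carrier G)"
    using card_conjugate[OF subgroup.subset[OF U(1)] inv_closed[OF g(1)]] conjugates_card[OF A] by auto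
  then show ?thesis
  proof
    assume "card U = card A"
    then show ?thesis
      using card_subset_eq[OF finite_subset_carrier[OF subgroup.subset[OF U(1)]] U(2)] by simp
  next
    assume "card U = card (carrier G)"
    then show ?thesis using card_subset_eq[OF fin subgroup.subset[OF U(1)]] by simp
  qed
qed

lemma permuting_conjugates_eq:
  assumes A: "A \<in> conjugates" and B: "B \<in> conjugates" and perm: "A <#> B = B <#> A"
  shows "A = B"
proof -
  have sA: "subgroup A G" and sB: "subgroup B G" using A B conjugates_subgroup by auto
  have AU: "A \<subseteq> A <#> B"
  proof
    fix a assume a: "a \<in> A"
    then have "a = a \<otimes> \<one>" using subgroup.mem_carrier[OF sA] by simp
    then show "a \<in> A <#> B" unfolding set_mult_def using a subgroup.one_closed[OF sB] by blast
  qed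
  have BU: "B \<subseteq> A <#> B"
  proof
    fix b assume b: "b \<in> B"
    then have "b = \<one> \<otimes> b" using subgroup.mem_carrier[OF sB] by simp
    then show "b \<in> A <#> B" unfolding set_mult_def using b subgroup.one_closed[OF sA] by blast
  qed
  have "A <#> B = A \<or> A <#> B = carrier G"
    by (rule subgroup_above_conjugate[OF A commuting_product_subgroup[OF sA sB perm] AU])
  then show ?thesis
  proof
    assume "A <#> B = A"
    then show ?thesis using BU conjugates_eqI[OF B A] by blast
  next
    assume top: "A <#> B = carrier G"
    obtain g where g: "g \<in> carrier G" "B = g <# A #> inv g"
      using nonnormal_subgroups_conjugate[OF gamma_one sA _ sB] conjugates_iff[OF sA] conjugates_iff[OF sB] A B
      by blast
    then have gA: "g \<in> A" using mem_if_product_conjugate_eq_carrier[OF sA g(1)] top by simp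
    have "B \<subseteq> A" unfolding g(2) conjugate_eq_image[OF subgroup.subset[OF sA] g(1)]
      using gA subgroup.m_closed[OF sA] subgroup.m_inv_closed[OF sA] by blast
    then show ?thesis using conjugates_eqI[OF B A] by blast
  qed
qed

lemma mem_normalizerI:
  assumes g: "g \<in> carrier G" and "\<And>x. x \<in> P \<Longrightarrow> g \<otimes> x \<otimes> inv g \<in> P"
  shows "g \<in> normalizer G P"
proof -
  have "g <# P #> inv g \<subseteq> P" unfolding conjugate_eq_image[OF P_subset g] using assms(2) by blast
  then have "g <# P #> inv g = P"
    using card_subset_eq[OF finite_subset_carrier[OF P_subset]] card_conjugate[OF P_subset g] by blast
  then show ?thesis unfolding normalizer_def stabilizer_def using g P_subset by simp
qed

lemma normalizer_P: "normalizer G P = P"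
proof -
  have "P \<subseteq> normalizer G P"
  proof
    fix g assume g: "g \<in> P"
    show "g \<in> normalizer G P"
      by (rule mem_normalizerI)
        (use g P_subset subgroup.m_closed[OF P] subgroup.m_inv_closed[OF P] in auto)
  qed
  then have "normalizer G P = P \<or> normalizer G P = carrier G"
    by (rule subgroup_above_P[OF normalizer_imp_subgroup[OF P_subset]])
  moreover have "normalizer G P \<noteq> carrier G"
  proof
    assume all: "normalizer G P = carrier G"
    have "g <# P #> inv g = P" if "g \<in> carrier G" for g
      using that all P_subset unfolding normalizer_def stabilizer_def by auto
    then have "g \<otimes> x \<otimes> inv g \<in> P" if "g \<in> carrier G" "x \<in> P" for g x
      using that(2) conjugate_eq_image[OF P_subset that(1)] that(1) by auto
    then show False using P_not_normal P unfolding normal_inv_iff by blast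
  qed
  ultimately show ?thesis by blast
qed

text \<open>Since \<open>G = NP\<close>, every conjugate of \<open>P\<close> comes from an element of \<open>N\<close>. If two elements of \<open>N\<close> give the same
  conjugate, their quotient normalizes \<open>P\<close> and therefore lies in \<open>N \<inter> P\<close>.\<close>

lemma card_conjugates: "card conjugates = card N"
proof -
  let ?f = "\<lambda>n. n <# P #> inv n"
  have "inj_on ?f N"
  proof (rule inj_onI)
    fix n m assume nm: "n \<in> N" "m \<in> N" and eq: "?f n = ?f m"
    then have c: "n \<in> carrier G" "m \<in> carrier G" using N_subset by auto
    have "inv m \<otimes> n \<in> normalizer G P"
    proof (rule mem_normalizerI)
      show "inv m \<otimes> n \<in> carrier G" using c by simp
      fix x assume x: "x \<in> P"
      then have "n \<otimes> x \<otimes> inv n \<in> ?f m" unfolding eq[symmetric] conjugate_eq_image[OF P_subset c(1)] by blast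
      then obtain y where y: "y \<in> P" "n \<otimes> x \<otimes> inv n = m \<otimes> y \<otimes> inv m"
        unfolding conjugate_eq_image[OF P_subset c(2)] by blast
      have xy: "x \<in> carrier G" "y \<in> carrier G" using x y(1) P_subset by auto
      have "inv m \<otimes> n \<otimes> x \<otimes> inv (inv m \<otimes> n) = inv m \<otimes> (n \<otimes> x \<otimes> inv n) \<otimes> m"
        using c xy by (simp add: m_assoc inv_mult_group)
      also have "\<dots> = y" unfolding y(2) using c xy by (simp add: m_assoc mult_inv_cancel)
      finally show "inv m \<otimes> n \<otimes> x \<otimes> inv (inv m \<otimes> n) \<in> P" using y(1) by simp
    qed
    moreover have "inv m \<otimes> n \<in> N" using nm subgroup.m_closed[OF N] subgroup.m_inv_closed[OF N] by simp
    ultimately have "inv m \<otimes> n = \<one>" unfolding normalizer_P using N_Int_P by blast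
    then have "m \<otimes> (inv m \<otimes> n) = m" using c by simp
    then show "n = m" using c by (simp add: mult_inv_cancel)
  qed
  moreover have "?f ` N = conjugates"
  proof (intro equalityI subsetI)
    fix A assume "A \<in> ?f ` N" then show "A \<in> conjugates" unfolding conjugates_def using N_subset by blast
  next
    fix A assume "A \<in> conjugates"
    then obtain g where g: "g \<in> carrier G" "A = g <# P #> inv g" unfolding conjugates_def by blast
    then have "g \<in> N <#> P" using NP by simp
    then obtain n u where nu: "n \<in> N" "u \<in> P" "g = n \<otimes> u" unfolding set_mult_def by blast
    then have c: "n \<in> carrier G" "u \<in> carrier G" using N_subset P_subset by auto
    have "A \<subseteq> ?f n"
    proof
      fix y assume "y \<in> A"
      then obtain x where x: "x \<in> P" "y = g \<otimes> x \<otimes> inv g"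
        unfolding g(2) conjugate_eq_image[OF P_subset g(1)] by blast
      have "y = n \<otimes> (u \<otimes> x \<otimes> inv u) \<otimes> inv n"
        unfolding x(2) nu(3) using c x(1) P_subset by (auto simp: m_assoc inv_mult_group)
      moreover have "u \<otimes> x \<otimes> inv u \<in> P"
        using nu(2) x(1) subgroup.m_closed[OF P] subgroup.m_inv_closed[OF P] by simp
      ultimately show "y \<in> ?f n" unfolding conjugate_eq_image[OF P_subset c(1)] by blast
    qed
    moreover have "?f n \<in> conjugates" unfolding conjugates_def using c by blast
    ultimately have "A = ?f n" using conjugates_eqI[OF \<open>A \<in> conjugates\<close>] by blast
    then show "A \<in> ?f ` N" using nu(1) by blast
  qed
  ultimately show ?thesis using card_image by metis
qed

abbreviation cyclics :: "'a set \<Rightarrow> 'a set set" where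
  "cyclics H \<equiv> cyclic_subgroups (G\<lparr>carrier := H\<rparr>)"

lemma finite_cyclics: "subgroup H G \<Longrightarrow> finite (cyclics H)"
  unfolding cyclic_subgroups_restrict_eq
  using finite_subset_carrier[OF subgroup.subset] by blast

lemma cyclics_carrier: "cyclics (carrier G) = cyclic_subgroups G"
  unfolding cyclic_subgroups_restrict_eq[OF subgroup_self] cyclic_subgroups_eq ..

lemma conjugates_cyclic: "conjugates \<subseteq> cyclic_subgroups G"
proof
  fix A assume "A \<in> conjugates"
  then obtain g where g: "g \<in> carrier G" "A = g <# P #> inv g" unfolding conjugates_def by blast
  obtain x where x: "x \<in> carrier G" "P = generate G {x}" using P_cyclic unfolding cyclic_subgroups_eq by blast
  have "A = generate G {g \<otimes> x \<otimes> inv g}" unfolding g(2) x(2) by (rule conjugate_generate[OF g(1) x(1)])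
  then show "A \<in> cyclic_subgroups G" unfolding cyclic_subgroups_eq using g(1) x(1) by blast
qed

text \<open>A normal \<open>K\<close> meeting \<open>N\<close> trivially lies in \<open>P\<close>: otherwise \<open>KP = G\<close>, and commutators would lie both
  in \<open>K\<close> and in \<open>N\<close>. If \<open>K\<close> contains \<open>N\<close> and is generated by \<open>nu\<close> with \<open>n \<in> N\<close> and \<open>u \<in> P\<close>, then \<open>K\<close> is also
  generated by \<open>N\<close> and \<open>u\<close>; here \<open>u\<close> cannot generate \<open>P\<close>, since \<open>G\<close> would be cyclic.\<close>

lemma normal_cyclic_subgroup:
  assumes K: "K \<in> cyclic_subgroups G" "K \<lhd> G"
  shows "K \<in> cyclics P - {P} \<union> (\<lambda>L. N <#> L) ` (cyclics P - {P})"
proof -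
  have sK: "subgroup K G" by (rule normal_imp_subgroup[OF K(2)])
  have "subgroup (K \<inter> N) G" by (rule subgroups_Inter_pair[OF sK N])
  then have "K \<inter> N = {\<one>} \<or> K \<inter> N = N"
    by (rule subgroup_of_prime_order[OF N prime_N]) blast
  then show ?thesis
  proof
    assume 1: "K \<inter> N = {\<one>}"
    have sKP: "subgroup (K <#> P) G" by (rule commuting_product_subgroup[OF sK P commut_normal[OF P K(2), symmetric]])
    have KU: "K \<subseteq> K <#> P"
    proof
      fix a assume a: "a \<in> K"
      then have "a = a \<otimes> \<one>" using subgroup.mem_carrier[OF sK] by simp
      then show "a \<in> K <#> P" unfolding set_mult_def using a subgroup.one_closed[OF P] by blast
    qed
    have PU: "P \<subseteq> K <#> P"
    proof
      fix b assume b: "b \<in> P"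
      then have "b = \<one> \<otimes> b" using subgroup.mem_carrier[OF P] by simp
      then show "b \<in> K <#> P" unfolding set_mult_def using b subgroup.one_closed[OF sK] by blast
    qed
    have "K <#> P \<noteq> carrier G"
    proof
      assume KP: "K <#> P = carrier G"
      have "a \<otimes> b = b \<otimes> a" if "a \<in> carrier G" "b \<in> carrier G" for a b
        using comm_if_abelian_quotients[OF K(2) P_subset KP cyclic_subgroup_comm[OF P_cyclic]
            N_normal P_subset NP cyclic_subgroup_comm[OF P_cyclic] 1 that] by blast
      then show False using gamma_one_not_comm[OF gamma_one] by blast
    qed
    then have "K <#> P = P" using subgroup_above_P[OF sKP PU] by blast
    then have "K \<subseteq> P" using KU by simp
    then have "K \<in> cyclics P" unfolding cyclic_subgroups_restrict[OF P] using K(1) by blast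
    moreover have "K \<noteq> P" using K(2) P_not_normal by blast
    ultimately show ?thesis by blast
  next
    assume "K \<inter> N = N"
    then have NK: "N \<subseteq> K" by blast
    obtain x where x: "x \<in> carrier G" "K = generate G {x}" using K(1) unfolding cyclic_subgroups_eq by blast
    have xK: "x \<in> K" unfolding x(2) by (rule generate.incl) simp
    have "x \<in> N <#> P" using NP x(1) by simp
    then obtain n u where nu: "n \<in> N" "u \<in> P" "x = n \<otimes> u" unfolding set_mult_def by blast
    then have c: "n \<in> carrier G" "u \<in> carrier G" using N_subset P_subset by auto
    let ?L = "generate G {u}"
    have L: "subgroup ?L G" by (rule generate_is_subgroup) (use c in simp)
    have uL: "u \<in> ?L" by (rule generate.incl) simp
    have LP: "?L \<in> cyclics P" unfolding cyclic_subgroups_restrict_eq[OF P] using nu(2) by blast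
    have "u = inv n \<otimes> x" using nu(3) c by (simp add: mult_inv_cancel)
    then have "u \<in> K" using NK nu(1) xK subgroup.m_closed[OF sK] subgroup.m_inv_closed[OF sK] by auto
    then have "?L \<subseteq> K" by (intro generate_subgroup_incl[OF _ sK]) simp
    then have "N <#> ?L \<subseteq> K <#> K" by (intro mono_set_mult NK)
    then have sub: "N <#> ?L \<subseteq> K" unfolding subgroup_mult_id[OF sK] .
    have "x \<in> N <#> ?L" unfolding nu(3) set_mult_def using nu(1) uL by blast
    then have "K \<subseteq> N <#> ?L" unfolding x(2)
      by (intro generate_subgroup_incl[OF _ commuting_product_subgroup[OF N L commut_normal[OF L N_normal, symmetric]]]) simp
    with sub have KNL: "K = N <#> ?L" by blast
    moreover have "?L \<noteq> P"
    proof
      assume "?L = P"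
      then have "K = carrier G" using KNL NP by simp
      then show False using cyclic_subgroup_comm[OF K(1)] gamma_one_not_comm[OF gamma_one] by blast
    qed
    ultimately show ?thesis using LP by blast
  qed
qed

lemma one_in_cyclics: "subgroup H G \<Longrightarrow> {\<one>} \<in> cyclics H"
  using cyclic_subgroups_restrict_eq[of H] subgroup.one_closed[of H G] generate_one
  by (metis image_eqI)

lemma P_ne_one: "P \<noteq> {\<one>}"
  using P_not_normal one_is_normal by auto

lemma P_in_cyclics: "P \<in> cyclics P"
  unfolding cyclic_subgroups_restrict[OF P] using P_cyclic by blast

lemma card_cyclics_P: "card (cyclics P) \<ge> 2"
proof -
  have "card {{\<one>}, P} \<le> card (cyclics P)"
    by (rule card_mono[OF finite_cyclics[OF P]]) (use one_in_cyclics[OF P] P_in_cyclics in blast)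
  then show ?thesis using P_ne_one by auto
qed

text \<open>This strict inequality separates the two values of \<open>csd\<close> different from \<open>1\<close>.\<close>

lemma card_cyclic_subgroups_less: "card (cyclic_subgroups G) < card N * card (cyclics P)"
proof -
  let ?D = "cyclics P - {P}"
  have fD: "finite ?D" using finite_cyclics[OF P] by blast
  have "cyclic_subgroups G \<subseteq> conjugates \<union> (?D \<union> (\<lambda>L. N <#> L) ` ?D)"
    using normal_cyclic_subgroup conjugates_iff unfolding cyclic_subgroups_def by blast
  moreover have "finite conjugates" unfolding conjugates_def using fin by blast
  ultimately have "card (cyclic_subgroups G) \<le> card (conjugates \<union> (?D \<union> (\<lambda>L. N <#> L) ` ?D))"
    using fD by (intro card_mono) auto
  also have "\<dots> \<le> card conjugates + (card ?D + card ((\<lambda>L. N <#> L) ` ?D))"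
    using card_Un_le order_trans add_left_mono by meson
  also have "\<dots> \<le> card N + (card ?D + card ?D)"
    unfolding card_conjugates using card_image_le[OF fD] by simp
  also have "card ?D = card (cyclics P) - 1"
    using P_in_cyclics by (rule card_Diff_singleton)
  finally have le: "card (cyclic_subgroups G) \<le> card N + (card (cyclics P) - 1 + (card (cyclics P) - 1))" .
  \<comment> \<open>With \<open>p = 3 + k\<close> and \<open>m = 2 + j\<close>, the gap \<open>p m - p - 2 (m - 1)\<close> is \<open>(k + 1) (j + 1)\<close>.\<close>
  obtain k where k: "card N = 3 + k" using card_N le_Suc_ex by blast
  obtain j where j: "card (cyclics P) = 2 + j" using card_cyclics_P le_Suc_ex by blast
  show ?thesis using le unfolding k j by (simp add: algebra_simps)
qed

lemma csd_by_conjugates: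
  assumes H: "subgroup H G"
  shows "csd H G = 1 - real (card {A \<in> conjugates. A \<subseteq> H} * (card N - 1))
    / (real (card (cyclics H)) * real (card (cyclic_subgroups G)))"
proof -
  have sub: "subgroup A G" if "A \<in> cyclic_subgroups G" for A
    using that unfolding cyclic_subgroups_def by blast
  have bad: "A <#> B \<noteq> B <#> A \<longleftrightarrow> A \<in> conjugates \<and> B \<in> conjugates \<and> A \<noteq> B"
    if "A \<in> cyclic_subgroups G" "B \<in> cyclic_subgroups G" for A B
    using commut_normal[OF sub[OF that(1)]] commut_normal[OF sub[OF that(2)]]
      conjugates_iff[OF sub[OF that(1)]] conjugates_iff[OF sub[OF that(2)]] permuting_conjugates_eq
    by metis
  have bad_eq: "{(A, B) \<in> cyclics H \<times> cyclic_subgroups G. A <#> B \<noteq> B <#> A}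
      = (SIGMA A:{A \<in> conjugates. A \<subseteq> H}. conjugates - {A})"
    (is "?L = ?R")
  proof (rule Set.set_eqI)
    fix z :: "'a set \<times> 'a set"
    obtain A B where z: "z = (A, B)" by force
    show "z \<in> ?L \<longleftrightarrow> z \<in> ?R"
      unfolding z cyclic_subgroups_restrict[OF H]
      using bad[of A B] subsetD[OF conjugates_cyclic, of A] subsetD[OF conjugates_cyclic, of B] by auto
  qed
  have "finite conjugates" unfolding conjugates_def using fin by blast
  then have "card ?R = (\<Sum>A\<in>{A \<in> conjugates. A \<subseteq> H}. card (conjugates - {A}))"
    by (intro card_SigmaI) auto
  also have "\<dots> = (\<Sum>A\<in>{A \<in> conjugates. A \<subseteq> H}. card N - 1)"
    using card_conjugates by (intro sum.cong) auto
  finally have "card ?R = card {A \<in> conjugates. A \<subseteq> H} * (card N - 1)" by simp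
  then show ?thesis unfolding csd_eq_one_minus_nonpermuting[OF fin H] bad_eq by (rule arg_cong)
qed

theorem card_Im_f1: "card (Im_f1 G) = 3"
proof -
  define p m c where "p = real (card N)" and "m = real (card (cyclics P))"
    and "c = real (card (cyclic_subgroups G))"
  have p1: "real (card N - 1) = p - 1" unfolding p_def using card_N by simp
  have p3: "p \<ge> 3" unfolding p_def using card_N by simp
  have m2: "m \<ge> 2" unfolding m_def using card_cyclics_P by simp
  have c_less: "c < p * m" unfolding c_def p_def m_def
    using card_cyclic_subgroups_less by (metis of_nat_less_iff of_nat_mult)
  have c0: "c > 0" unfolding c_def
    using P_cyclic finite_cyclics[OF subgroup_self] cyclics_carrier by (auto simp: card_gt_0_iff)
  have csd_P: "csd H G = 1 - (p - 1) / (m * c)" if H: "H \<in> conjugates" for H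
  proof -
    have sH: "subgroup H G" by (rule conjugates_subgroup[OF H])
    obtain g where g: "g \<in> carrier G" "H = g <# P #> inv g" using H unfolding conjugates_def by blast
    have "{A \<in> conjugates. A \<subseteq> H} = {H}" using conjugates_eqI[OF _ H] H by blast
    moreover have "card (cyclics H) = card (cyclics P)"
      unfolding g(2) by (rule card_cyclic_subgroups_conjugate[OF P g(1)])
    ultimately show ?thesis
      using csd_by_conjugates[OF sH] p1 unfolding m_def c_def by simp
  qed
  have csd_G: "csd (carrier G) G = 1 - p * (p - 1) / (c * c)"
  proof -
    have "{A \<in> conjugates. A \<subseteq> carrier G} = conjugates"
      using conjugates_subgroup subgroup.subset by blast
    then show ?thesis
      using csd_by_conjugates[OF subgroup_self] p1 card_conjugates
      unfolding cyclics_carrier p_def c_def by simp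
  qed
  have csd_1: "csd H G = 1" if H: "subgroup H G" "H \<notin> conjugates" "H \<noteq> carrier G" for H
  proof -
    have none: "{A \<in> conjugates. A \<subseteq> H} = {}"
      using subgroup_above_conjugate[OF _ H(1)] H(2,3) by blast
    show ?thesis unfolding csd_by_conjugates[OF H(1)] none by simp
  qed
  have one: "subgroup {\<one>} G" "{\<one>} \<notin> conjugates" "{\<one>} \<noteq> carrier G"
    using triv_subgroup conjugates_iff[OF triv_subgroup] one_is_normal P_ne_one P_subset
      subgroup.one_closed[OF P] by auto
  have "Im_f1 G = {1, 1 - (p - 1) / (m * c), 1 - p * (p - 1) / (c * c)}"
  proof (intro equalityI subsetI)
    fix v assume "v \<in> Im_f1 G"
    then obtain H where H: "subgroup H G" "v = csd H G" unfolding Im_f1_def subgroups_def by blast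
    then show "v \<in> {1, 1 - (p - 1) / (m * c), 1 - p * (p - 1) / (c * c)}"
      using csd_P csd_G csd_1 by blast
  next
    fix v assume "v \<in> {1, 1 - (p - 1) / (m * c), 1 - p * (p - 1) / (c * c)}"
    then have "v = csd {\<one>} G \<or> v = csd P G \<or> v = csd (carrier G) G"
      using csd_P[OF P_in_conjugates] csd_G csd_1[OF one] by auto
    then show "v \<in> Im_f1 G" unfolding Im_f1_def subgroups_def using P one(1) subgroup_self by blast
  qed
  moreover have "1 \<noteq> 1 - (p - 1) / (m * c)" "1 \<noteq> 1 - p * (p - 1) / (c * c)"
    using p3 m2 c0 by auto
  moreover have "1 - (p - 1) / (m * c) \<noteq> 1 - p * (p - 1) / (c * c)"
  proof
    assume "1 - (p - 1) / (m * c) = 1 - p * (p - 1) / (c * c)"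
    then have "(p - 1) / (m * c) = p * (p - 1) / (c * c)" by simp
    then have "(p - 1) * (c * c) = p * (p - 1) * (m * c)" using m2 c0 by (simp add: frac_eq_eq)
    then have "((p - 1) * c) * c = ((p - 1) * c) * (p * m)" by (simp add: algebra_simps)
    then have "c = p * m" using p3 c0 by simp
    then show False using c_less by simp
  qed
  ultimately show ?thesis by (auto simp: card_insert_if)
qed

end

section \<open>The semidirect products\<close>

text \<open>The group of type (1) may live on another type, so its factors are moved along the isomorphism.\<close>

lemma semidirect_product_iso:
  assumes G: "group G" and h: "h \<in> iso K G" and K: "semidirect_product K N P"
  shows "semidirect_product G (h ` N) (h ` P)"
proof -
  have norm: "N \<lhd> K" and P: "subgroup P K" and NP: "N <#>\<^bsub>K\<^esub> P = carrier K"
    and Int: "N \<inter> P = {\<one>\<^bsub>K\<^esub>}" and gK: "group K"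
    using K unfolding semidirect_product_def by auto
  interpret K: group K by (rule gK)
  interpret G: group G by (rule G)
  interpret h: group_hom K G h by unfold_locales (use h in \<open>simp add: iso_def\<close>)
  have inj: "inj_on h (carrier K)" and surj: "h ` carrier K = carrier G"
    using h by (auto simp: iso_def bij_betw_def)
  have N: "subgroup N K" by (rule normal_imp_subgroup[OF norm])
  note sub = subgroup.subset[OF N] subgroup.subset[OF P]
  have "h ` N \<lhd> G"
    unfolding G.normal_inv_iff
  proof (intro conjI ballI)
    show "subgroup (h ` N) G" by (rule h.subgroup_img_is_subgroup[OF N])
    fix x y assume "x \<in> carrier G" "y \<in> h ` N"
    then obtain k n where kn: "k \<in> carrier K" "x = h k" "n \<in> N" "y = h n"
      unfolding surj[symmetric] by blast
    have "k \<otimes>\<^bsub>K\<^esub> n \<otimes>\<^bsub>K\<^esub> inv\<^bsub>K\<^esub> k \<in> N" using norm kn(1,3) unfolding K.normal_inv_iff by blast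
    moreover have "h (k \<otimes>\<^bsub>K\<^esub> n \<otimes>\<^bsub>K\<^esub> inv\<^bsub>K\<^esub> k) = x \<otimes>\<^bsub>G\<^esub> y \<otimes>\<^bsub>G\<^esub> inv\<^bsub>G\<^esub> x"
      using kn subsetD[OF sub(1) kn(3)] by simp
    ultimately show "x \<otimes>\<^bsub>G\<^esub> y \<otimes>\<^bsub>G\<^esub> inv\<^bsub>G\<^esub> x \<in> h ` N" by (metis imageI)
  qed
  moreover have "subgroup (h ` P) G" by (rule h.subgroup_img_is_subgroup[OF P])
  moreover have "h ` N <#>\<^bsub>G\<^esub> h ` P = carrier G"
    using set_mult_hom[OF h.homh sub] NP surj by simp
  moreover have "h ` N \<inter> h ` P = {\<one>\<^bsub>G\<^esub>}"
    using inj_on_image_Int[OF inj sub] Int by simp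
  ultimately show ?thesis unfolding semidirect_product_def using G by blast
qed

lemma (in group_hom) image_cyclic_subgroup:
  assumes "K \<in> cyclic_subgroups G"
  shows "h ` K \<in> cyclic_subgroups H"
proof -
  obtain x where x: "x \<in> carrier G" "K = generate G {x}"
    using assms unfolding G.cyclic_subgroups_eq by blast
  then have "h ` K = generate H {h x}" using generate_img[of "{x}"] by simp
  then show ?thesis unfolding H.cyclic_subgroups_eq by (rule image_eqI) (use x(1) in simp)
qed

lemma cyclic_integer_mod_group:
  assumes "m > 1"
  shows "cyclic_group (integer_mod_group m)"
proof -
  have "k \<in> range (\<lambda>i. i mod int m)" if "0 \<le> k" "k < int m" for k
    by (rule range_eqI[of _ _ k]) (use that in simp)
  then have "carrier (integer_mod_group m) = range (\<lambda>i::int. 1 [^]\<^bsub>integer_mod_group m\<^esub> i)"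
    using assms by (auto simp: carrier_integer_mod_group int_pow_integer_mod_group)
  moreover have "1 \<in> carrier (integer_mod_group m)" using assms by simp
  ultimately show ?thesis using group.cyclic_group[OF group_integer_mod_group] by blast
qed

lemma (in group) type1_card_Im_f1:
  assumes fin: "finite (carrier G)" and gamma: "gamma G = 1" and t: "type1 K p q n" and iso: "G \<cong> K"
  shows "card (Im_f1 G) = 3"
proof -
  obtain N P where NP: "semidirect_product K N P"
    and N: "K\<lparr>carrier := N\<rparr> \<cong> integer_mod_group p"
    and P: "K\<lparr>carrier := P\<rparr> \<cong> integer_mod_group (q ^ n)"
    and p: "prime p" and q: "prime q" "q dvd p - 1" and n: "n > 0"
    using t unfolding type1_def by blast
  have gK: "group K" and sP: "subgroup P K" and sN: "subgroup N K"
    using NP normal_imp_subgroup unfolding semidirect_product_def by auto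
  obtain h where h: "h \<in> iso K G" using iso_sym[OF iso] unfolding is_iso_def by blast
  interpret h: group_hom K G h
    by (intro group_hom.intro gK is_group group_hom_axioms.intro) (use h in \<open>simp add: iso_def\<close>)
  have inj: "inj_on h (carrier K)" using h by (auto simp: iso_def bij_betw_def)
  have "card N = p"
    using iso_same_card[OF N] p by (simp add: carrier_integer_mod_group prime_gt_0_nat)
  then have cardN: "card (h ` N) = p"
    using card_image[OF inj_on_subset[OF inj subgroup.subset[OF sN]]] by simp
  \<comment> \<open>This rules out \<open>p = 2\<close>, where the count of cyclic subgroups gives only \<open>c \<le> p m\<close>.\<close>
  have "q \<le> p - 1" using q(2) prime_gt_1_nat[OF p] by (intro dvd_imp_le) auto
  then have p3: "p \<ge> 3" using prime_ge_2_nat[OF q(1)] by linarith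
  have "cyclic_group (integer_mod_group (q ^ n))"
    by (rule cyclic_integer_mod_group) (use one_less_power[OF prime_gt_1_nat[OF q(1)] n] in simp)
  then have "cyclic_group (K\<lparr>carrier := P\<rparr>)"
    using isomorphic_group_cyclicity[OF P subgroup.subgroup_is_group[OF sP gK] group_integer_mod_group] by simp
  then have "P \<in> cyclic_subgroups K" using sP unfolding cyclic_subgroups_def by simp
  then have cycP: "h ` P \<in> cyclic_subgroups G" by (rule h.image_cyclic_subgroup)
  have "semidirect_product G (h ` N) (h ` P)" by (rule semidirect_product_iso[OF is_group h NP])
  then have "prime_by_cyclic G (h ` N) (h ` P)"
    unfolding semidirect_product_def using fin gamma cardN p p3 cycP
    by (intro prime_by_cyclic.intro is_group prime_by_cyclic_axioms.intro) simp_all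
  then show ?thesis by (rule prime_by_cyclic.card_Im_f1)
qed

theorem theorem3p9:
  fixes G :: "('a, 'm) monoid_scheme"
  assumes "group G" and "finite (carrier G)" and "gamma G = 1"
  shows "((\<exists>(K :: 'b monoid) p q n. type1 K p q n \<and> G \<cong> K) \<longrightarrow> card (Im_f1 G) = 3) \<and>
         ((\<exists>p n. type2 G p n) \<longrightarrow> card (Im_f1 G) = 1)"
  using group.type1_card_Im_f1[OF assms] group.type2_Im_f1[OF assms] by auto

end
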